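(* (Addition Theorem) Let $n\ge 1$ be an integer, let $q_0=1$ and $0<q_i<1$ for $i=1,\dots,n$, and let $a_0,a_1,\dots,a_n\in\mathbb{R}$. Then for all $x,y\in\mathbb{R}$, $$\mathcal{R}(\bar a;\bar q;x+y)=\sum_{r=0}^\infty \frac{x^r}{r!}\,\mathcal{R}^{(r)}(\bar a;\bar q;y).$$
   Context: Notation: $\bar a=(a_0,\dots,a_n)$, $\bar q=(q_0,\dots,q_n)$, and $(\bar a;\bar q)_m=\prod_{j=0}^{m-1}\left(\sum_{i=0}^n a_iq_i^j\right)$ for $m\ge 1$, with $(\bar a;\bar q)_0=1$. The special function $\mathcal{R}$ is defined by the (everywhere convergent) power series $\mathcal{R}(\bar a;\bar q;x)=\sum_{m=0}^\infty \frac{x^m}{m!}(\bar a;\bar q)_m$, and $\mathcal{R}^{(r)}(\bar a;\bar q;x)=\frac{d^r}{dx^r}\mathcal{R}(\bar a;\bar q;x)$ denotes its $r$-th derivative with respect to $x$. *)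

theory Defs
  imports "HOL-Analysis.Analysis"
begin

text \<open>
  The tuples \<open>(a\<^sub>0, \<dots>, a\<^sub>n)\<close> and \<open>(q\<^sub>0, \<dots>, q\<^sub>n)\<close> are represented by functions on the
  naturals, of which only the values at \<open>0, \<dots>, n\<close> are used.
\<close>

definition multi_pochhammer :: "nat \<Rightarrow> (nat \<Rightarrow> real) \<Rightarrow> (nat \<Rightarrow> real) \<Rightarrow> nat \<Rightarrow> real" where
  "multi_pochhammer n a q m = (\<Prod>j<m. \<Sum>i\<le>n. a i * q i ^ j)"

definition R_fun :: "nat \<Rightarrow> (nat \<Rightarrow> real) \<Rightarrow> (nat \<Rightarrow> real) \<Rightarrow> real \<Rightarrow> real" where
  "R_fun n a q x = (\<Sum>m. x ^ m / fact m * multi_pochhammer n a q m)"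

definition R_fun_deriv :: "nat \<Rightarrow> nat \<Rightarrow> (nat \<Rightarrow> real) \<Rightarrow> (nat \<Rightarrow> real) \<Rightarrow> real \<Rightarrow> real" where
  "R_fun_deriv r n a q = (deriv ^^ r) (R_fun n a q)"

text \<open>For \<open>\<bar>q\<^sub>i\<bar> \<le> 1\<close> the defining series converges everywhere, so \<^const>\<open>suminf\<close> yields its actual sum.\<close>

lemma summable_R_fun:
  assumes q: "\<And>i. i \<le> n \<Longrightarrow> \<bar>q i\<bar> \<le> 1"
  shows "summable (\<lambda>m. x ^ m / fact m * multi_pochhammer n a q m)"
proof (rule summable_comparison_test')
  define C where "C = (\<Sum>i\<le>n. \<bar>a i\<bar>)"
  show "summable (\<lambda>m. inverse (fact m) * (\<bar>x\<bar> * C) ^ m)"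
    by (rule summable_exp)
  have factor: "\<bar>\<Sum>i\<le>n. a i * q i ^ j\<bar> \<le> C" for j
  proof -
    have "\<bar>\<Sum>i\<le>n. a i * q i ^ j\<bar> \<le> (\<Sum>i\<le>n. \<bar>a i * q i ^ j\<bar>)"
      by (rule sum_abs)
    also have "\<dots> \<le> C"
      unfolding C_def
      by (rule sum_mono) (use q in \<open>auto simp: abs_mult power_abs intro!: mult_left_le power_le_one\<close>)
    finally show ?thesis .
  qed
  have bound: "\<bar>multi_pochhammer n a q m\<bar> \<le> C ^ m" for m
  proof -
    have "(\<Prod>j<m. \<bar>\<Sum>i\<le>n. a i * q i ^ j\<bar>) \<le> (\<Prod>j<m. C)"
      by (rule prod_mono) (use factor in auto)
    then show ?thesis
      by (simp add: multi_pochhammer_def abs_prod)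
  qed
  show "norm (x ^ m / fact m * multi_pochhammer n a q m) \<le> inverse (fact m) * (\<bar>x\<bar> * C) ^ m" for m
  proof -
    have "norm (x ^ m / fact m * multi_pochhammer n a q m)
        = \<bar>x\<bar> ^ m / fact m * \<bar>multi_pochhammer n a q m\<bar>"
      by (simp add: abs_mult power_abs)
    also have "\<dots> \<le> \<bar>x\<bar> ^ m / fact m * C ^ m"
      by (rule mult_left_mono[OF bound]) simp
    finally show ?thesis
      by (simp add: power_mult_distrib field_simps)
  qed
qed

end

theory Submission
  imports Defs
begin

text \<open>
  The addition theorem says that the entire function \<open>\<R>\<close> equals its Taylor series about \<open>y\<close>.
  When \<open>\<bar>q\<^sub>i\<bar> \<le> 1\<close>, every factor of the product \<open>(a; q)\<^sub>m\<close> is bounded by \<open>C = \<Sum>\<^sub>i \<bar>a\<^sub>i\<bar>\<close>, so the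
  coefficients of the exponential generating function \<open>\<R>\<close> grow at most like \<open>C\<^sup>m\<close>.
  Differentiating an exponential generating function shifts its coefficient sequence by one
  (\<open>has_field_derivative_egf\<close>), which turns this growth into the explicit derivative bound
  \<open>\<bar>\<R>\<^sup>(\<^sup>r\<^sup>)(t)\<bar> \<le> C\<^sup>r exp (\<bar>t\<bar> C)\<close> (\<open>abs_egf_shift_le\<close>). The Lagrange remainder of order \<open>r\<close>
  between \<open>y\<close> and \<open>x + y\<close> is therefore at most a constant times \<open>(\<bar>x\<bar> C)\<^sup>r / r!\<close>, the general
  term of an exponential series, and tends to \<open>0\<close> (\<open>egf_taylor_sums\<close>).
\<close>

definition egf :: "(nat \<Rightarrow> real) \<Rightarrow> real \<Rightarrow> real" where
  "egf c x = (\<Sum>m. x ^ m / fact m * c m)"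

lemma R_fun_eq_egf: "R_fun n a q = egf (multi_pochhammer n a q)"
  by (simp add: fun_eq_iff R_fun_def egf_def)

lemma abs_egf_term_le:
  fixes c :: "nat \<Rightarrow> real"
  assumes "\<And>m. \<bar>c m\<bar> \<le> K * C ^ m"
  shows "\<bar>x ^ m / fact m * c m\<bar> \<le> K * (inverse (fact m) * (\<bar>x\<bar> * C) ^ m)"
proof -
  have "\<bar>x ^ m / fact m * c m\<bar> = \<bar>x\<bar> ^ m / fact m * \<bar>c m\<bar>"
    by (simp add: abs_mult power_abs)
  also have "\<dots> \<le> \<bar>x\<bar> ^ m / fact m * (K * C ^ m)"
    by (rule mult_left_mono[OF assms]) simp
  finally show ?thesis
    by (simp add: power_mult_distrib field_simps)
qed

lemma summable_egf:
  fixes c :: "nat \<Rightarrow> real"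
  assumes "\<And>m. \<bar>c m\<bar> \<le> K * C ^ m"
  shows "summable (\<lambda>m. x ^ m / fact m * c m)"
proof (rule summable_comparison_test')
  show "summable (\<lambda>m. K * (inverse (fact m) * (\<bar>x\<bar> * C) ^ m))"
    by (intro summable_mult summable_exp)
  show "norm (x ^ m / fact m * c m) \<le> K * (inverse (fact m) * (\<bar>x\<bar> * C) ^ m)" for m
    using abs_egf_term_le[of c K C, OF assms] by simp
qed

lemma abs_egf_le:
  fixes c :: "nat \<Rightarrow> real"
  assumes "\<And>m. \<bar>c m\<bar> \<le> K * C ^ m"
  shows "\<bar>egf c x\<bar> \<le> K * exp (\<bar>x\<bar> * C)"
proof -
  let ?g = "\<lambda>m. K * (inverse (fact m) * (\<bar>x\<bar> * C) ^ m)"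
  have g: "?g sums (K * exp (\<bar>x\<bar> * C))"
    using exp_converges[of "\<bar>x\<bar> * C"] by (intro sums_mult) simp
  have "norm (\<Sum>m. x ^ m / fact m * c m) \<le> suminf ?g"
    using abs_egf_term_le[of c K C, OF assms] sums_summable[OF g]
    by (intro norm_suminf_le) simp_all
  then show ?thesis
    using sums_unique[OF g] by (simp add: egf_def)
qed

lemma abs_shift_le:
  fixes c :: "nat \<Rightarrow> real"
  assumes "\<And>m. \<bar>c m\<bar> \<le> K * C ^ m"
  shows "\<bar>c (m + r)\<bar> \<le> (K * C ^ r) * C ^ m"
  using assms[of "m + r"] by (simp add: power_add algebra_simps)

text \<open>
  A shift by \<open>r\<close> only multiplies the constant in the coefficient bound by \<open>C\<^sup>r\<close>, and the shifted
  series is the \<open>r\<close>-th derivative; so on bounded sets the derivatives grow at most geometrically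
  in \<open>r\<close>, which the factor \<open>1 / r!\<close> in the Taylor remainder outweighs.
\<close>

lemma abs_egf_shift_le:
  fixes c :: "nat \<Rightarrow> real"
  assumes "\<And>m. \<bar>c m\<bar> \<le> K * C ^ m"
  shows "\<bar>egf (\<lambda>m. c (m + r)) x\<bar> \<le> (K * C ^ r) * exp (\<bar>x\<bar> * C)"
  by (rule abs_egf_le) (rule abs_shift_le[of c K C, OF assms])

text \<open>The factor \<open>m + 1\<close> from differentiating \<open>x\<^sup>m\<^sup>+\<^sup>1\<close> cancels against the factorial \<open>(m + 1)!\<close>.\<close>

lemma has_field_derivative_egf:
  fixes c :: "nat \<Rightarrow> real"
  assumes "\<And>m. \<bar>c m\<bar> \<le> K * C ^ m"
  shows "(egf c has_field_derivative egf (\<lambda>m. c (Suc m)) x) (at x)"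
proof -
  have "summable (\<lambda>m. c m / fact m * t ^ m)" for t
    using summable_egf[of c K C t, OF assms] by (simp add: mult.commute)
  then have "((\<lambda>x. \<Sum>m. c m / fact m * x ^ m) has_field_derivative
      (\<Sum>m. diffs (\<lambda>m. c m / fact m) m * x ^ m)) (at x)"
    by (rule termdiffs_strong_converges_everywhere)
  moreover have "(\<lambda>x. \<Sum>m. c m / fact m * x ^ m) = egf c"
    by (simp add: fun_eq_iff egf_def mult.commute)
  moreover have "diffs (\<lambda>m. c m / fact m) m * x ^ m = x ^ m / fact m * c (Suc m)" for m
    by (simp add: diffs_def field_simps del: of_nat_Suc)
  ultimately show ?thesis
    by (simp add: egf_def)
qed

lemma has_field_derivative_egf_shift:
  fixes c :: "nat \<Rightarrow> real"
  assumes "\<And>m. \<bar>c m\<bar> \<le> K * C ^ m"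
  shows "(egf (\<lambda>m. c (m + r)) has_field_derivative egf (\<lambda>m. c (m + Suc r)) x) (at x)"
  using has_field_derivative_egf[of "\<lambda>m. c (m + r)", OF abs_shift_le[of c K C, OF assms]]
  by simp

lemma higher_deriv_egf:
  fixes c :: "nat \<Rightarrow> real"
  assumes "\<And>m. \<bar>c m\<bar> \<le> K * C ^ m"
  shows "(deriv ^^ r) (egf c) = egf (\<lambda>m. c (m + r))"
proof (induction r)
  case (Suc r)
  have "deriv (egf (\<lambda>m. c (m + r))) = egf (\<lambda>m. c (m + Suc r))"
    by (intro ext DERIV_imp_deriv has_field_derivative_egf_shift[of c K C, OF assms])
  with Suc show ?case by simp
qed simp

theorem egf_taylor_sums:
  fixes c :: "nat \<Rightarrow> real"
  assumes c: "\<And>m. \<bar>c m\<bar> \<le> K * C ^ m" and "C \<ge> 0"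
  shows "(\<lambda>r. x ^ r / fact r * (deriv ^^ r) (egf c) y) sums egf c (x + y)"
proof -
  define D where "D r t = egf (\<lambda>m. c (m + r)) (t + y)" for r t
  define M where "M = K * exp ((\<bar>x\<bar> + \<bar>y\<bar>) * C)"
  have K: "K \<ge> 0"
    using c[of 0] by simp
  have D_deriv: "(D r has_field_derivative D (Suc r) t) (at t)" for r t
    unfolding D_def by (rule iffD1[OF DERIV_shift has_field_derivative_egf_shift]) (rule c)
  have remainder: "\<bar>(\<Sum>r<k. x ^ r / fact r * D r 0) - D 0 x\<bar>
      \<le> M * (inverse (fact k) * (\<bar>x\<bar> * C) ^ k)" for k
  proof -
    obtain t where t: "\<bar>t\<bar> \<le> \<bar>x\<bar>"
      and eq: "D 0 x = (\<Sum>r<k. D r 0 / fact r * x ^ r) + D k t / fact k * x ^ k"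
      using Maclaurin_all_le[of D "D 0" x k] D_deriv by blast
    have "\<bar>(\<Sum>r<k. x ^ r / fact r * D r 0) - D 0 x\<bar> = \<bar>D k t\<bar> * (\<bar>x\<bar> ^ k / fact k)"
      by (simp add: eq mult.commute abs_mult power_abs)
    also have "\<dots> \<le> ((K * C ^ k) * exp ((\<bar>x\<bar> + \<bar>y\<bar>) * C)) * (\<bar>x\<bar> ^ k / fact k)"
    proof (rule mult_right_mono)
      have "\<bar>D k t\<bar> \<le> (K * C ^ k) * exp (\<bar>t + y\<bar> * C)"
        unfolding D_def by (rule abs_egf_shift_le) (rule c)
      also have "\<dots> \<le> (K * C ^ k) * exp ((\<bar>x\<bar> + \<bar>y\<bar>) * C)"
        using t K \<open>C \<ge> 0\<close> by (intro mult_left_mono) (auto intro!: mult_right_mono)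
      finally show "\<bar>D k t\<bar> \<le> (K * C ^ k) * exp ((\<bar>x\<bar> + \<bar>y\<bar>) * C)" .
    qed simp
    finally show ?thesis
      by (simp add: M_def power_mult_distrib field_simps)
  qed
  have "(\<lambda>k. M * (inverse (fact k) * (\<bar>x\<bar> * C) ^ k)) \<longlonglongrightarrow> 0"
    using tendsto_mult_right_zero[OF summable_LIMSEQ_zero[OF summable_exp]] .
  then have "(\<lambda>k. (\<Sum>r<k. x ^ r / fact r * D r 0) - D 0 x) \<longlonglongrightarrow> 0"
    by (rule Lim_null_comparison[rotated]) (use remainder in simp)
  then have "(\<lambda>r. x ^ r / fact r * D r 0) sums D 0 x"
    unfolding sums_def by (rule LIM_zero_cancel)
  then show ?thesis
    by (simp add: D_def higher_deriv_egf[of c K C, OF c])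
qed

lemma abs_multi_pochhammer_le:
  assumes q: "\<And>i. i \<le> n \<Longrightarrow> \<bar>q i\<bar> \<le> 1"
  shows "\<bar>multi_pochhammer n a q m\<bar> \<le> (\<Sum>i\<le>n. \<bar>a i\<bar>) ^ m"
proof -
  have "\<bar>\<Sum>i\<le>n. a i * q i ^ j\<bar> \<le> (\<Sum>i\<le>n. \<bar>a i\<bar>)" for j
  proof -
    have "\<bar>\<Sum>i\<le>n. a i * q i ^ j\<bar> \<le> (\<Sum>i\<le>n. \<bar>a i * q i ^ j\<bar>)"
      by (rule sum_abs)
    also have "\<dots> \<le> (\<Sum>i\<le>n. \<bar>a i\<bar>)"
      using q by (intro sum_mono) (auto simp: abs_mult power_abs intro!: mult_left_le power_le_one)
    finally show ?thesis .
  qed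
  then have "(\<Prod>j<m. \<bar>\<Sum>i\<le>n. a i * q i ^ j\<bar>) \<le> (\<Prod>j<m. \<Sum>i\<le>n. \<bar>a i\<bar>)"
    by (intro prod_mono) auto
  then show ?thesis
    by (simp add: multi_pochhammer_def abs_prod)
qed

theorem theorem6p3:
  fixes n :: nat and a q :: "nat \<Rightarrow> real" and x y :: real
  assumes "n \<ge> 1"
    and "q 0 = 1"
    and "\<And>i. 1 \<le> i \<Longrightarrow> i \<le> n \<Longrightarrow> 0 < q i \<and> q i < 1"
  shows "(\<lambda>r. x ^ r / fact r * R_fun_deriv r n a q y) sums R_fun n a q (x + y)"
proof -
  have "\<bar>q i\<bar> \<le> 1" if "i \<le> n" for i
    using assms(2) assms(3)[of i] that by (cases "i = 0") auto
  then have "\<bar>multi_pochhammer n a q m\<bar> \<le> 1 * (\<Sum>i\<le>n. \<bar>a i\<bar>) ^ m" for m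
    using abs_multi_pochhammer_le by simp
  then show ?thesis
    unfolding R_fun_deriv_def R_fun_eq_egf
    by (rule egf_taylor_sums) (simp add: sum_nonneg)
qed

end
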